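(* Let $G_{\mathrm{DU}}$ be an acyclic directed-undirected (DU) graph and let $G_D$ be its directed core. For every admissible directed completion $\widetilde G_{\mathrm{DU}}$ of $G_{\mathrm{DU}}$, $$\mathcal C_{\widetilde G_{\mathrm{DU}}}\bigl(G_{\mathrm{DU}};\boldsymbol\beta,\boldsymbol\gamma\bigr)=\Bigl(\prod_{u\in E_U(G_{\mathrm{DU}})}\gamma_u\Bigr)\,\omega_c(G_D;\boldsymbol\beta),$$ where the right-hand side is understood to be zero when $G_D$ is disconnected. In particular, the sector coefficient $\mathcal C_{\widetilde G_{\mathrm{DU}}}$ is independent of the admissible directed completion.
   Context: A (finite) quiver $G=(V_G,E_G,\rho_G)$ has finite sets $V_G,E_G$ and $\rho_G:E_G\to V_G\times V_G$, where $\rho_G(\varepsilon)=(u,v)$ is written $\varepsilon:u\to v$; parallel edges, directed cycles and tadpoles ($u\to u$) are allowed; acyclic means no directed cycle (tadpoles count as directed cycles); connected means nonempty with connected underlying undirected graph, disconnected otherwise. Edges carry independent parameters $\beta_\varepsilon$ over a field of characteristic zero, kept by edges surviving in subquivers/contractions; $\beta_{\varepsilon,\pm}=(\beta_\varepsilon\pm1)/2$. A cut-subquiver $H\preceq G$ has vertex set $V_G$ and any $E_H\subseteq E_G$; the contraction $G/H$ has vertices the connected components of $H$ and edges $E_G\setminus E_H$ with induced incidences. For tadpole-free $G$, $e_0(G)=|\operatorname{LE}(G)|/|V_G|!$ if $G$ is acyclic ($\operatorname{LE}(G)$ = linear extensions of the partial order induced by the edges), $e_0(G)=0$ otherwise;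 in general $e(G;\boldsymbol\beta)=\bigl(\prod_{\varepsilon\text{ tadpole}}(-\beta_{\varepsilon,-})\bigr)e_0(G_{\mathrm{pruned}})$ with $G_{\mathrm{pruned}}$ obtained by deleting all tadpoles. $\omega$ is the unique function on quivers with $\sum_{H\preceq G}\omega(H)e(G/H)=\epsilon(G)$, $\epsilon(G)=1$ if $E_G=\emptyset$ and $0$ otherwise; $\omega_c(G)=\omega(G)$ for connected $G$, and $\omega_c(G)=0$ otherwise. An RB graph is a quiver with each edge colored red ($r$) or blue ($b$); $E_r(G),E_b(G)$ are the red and blue edge sets, $b(G)=|E_b(G)|$, and $\omega_{RB,c}(G)=(-1)^{b(G)}\omega_c(G;\boldsymbol\beta)$ at $\beta_\varepsilon=1$ on red and $\beta_\varepsilon=-1$ on blue edges (zero if $G$ is disconnected). A DU graph is a finite graph whose edge set is a disjoint union $E_D(G)\sqcup E_U(G)$ of directed edges and undirected edges (multiple edges allowed); each $\varepsilon\in E_D(G)$ carries an independent parameter $\beta_\varepsilon$ and each $u\in E_U(G)$ an independent parameter $\gamma_u$. Its directed core $G_D$ is the quiver obtained by deleting all undirected edges and keeping all vertices. It is acyclic if it has no tadpoles and $G_D$ is acyclic. An admissible directed completion $\widetilde G_{\mathrm{DU}}$ of an acyclic DU graph is a quiver obtained by orienting every undirected edge so that the result is acyclic (orientations of edges in $E_D$ are kept). Let $X(\widetilde G_{\mathrm{DU}})$ be the set of RB graphs obtained by coloring every edge of $\widetilde G_{\mathrm{DU}}$ red or blue (all $2^{|E|}$ colorings). For $G_{RB}\in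 X(\widetilde G_{\mathrm{DU}})$ let $E_{D,r}(G_{RB})=E_D(G_{\mathrm{DU}})\cap E_r(G_{RB})$ and $E_{D,b}(G_{RB})=E_D(G_{\mathrm{DU}})\cap E_b(G_{RB})$. The sector coefficient is $$\mathcal C_{\widetilde G_{\mathrm{DU}}}\bigl(G_{\mathrm{DU}};\boldsymbol\beta,\boldsymbol\gamma\bigr)=\Bigl(\prod_{u\in E_U(G_{\mathrm{DU}})}\gamma_u\Bigr)\sum_{G_{RB}\in X(\widetilde G_{\mathrm{DU}})}\Bigl(\prod_{\varepsilon\in E_{D,r}(G_{RB})}\beta_{\varepsilon,+}\Bigr)\Bigl(\prod_{\varepsilon\in E_{D,b}(G_{RB})}\beta_{\varepsilon,-}\Bigr)\omega_{RB,c}(G_{RB}).$$ *)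

theory Defs
  imports Complex_Main "HOL-Library.FuncSet" "Graph_Theory.Graph_Theory"
begin

text \<open>
  A finite quiver is a value \<open>G :: ('v, 'e) pre_digraph\<close> with \<open>fin_digraph G\<close>: parallel arcs and
  loops (tadpoles) are allowed, and so is the quiver without vertices. The library predicate
  \<open>connected\<close> already requires a nonempty vertex set and refers to the underlying undirected graph.
  The cut-subquivers of \<open>G\<close> are the \<open>H\<close> with \<open>spanning H G\<close>.

  Edge parameters are functions from edges to a field of characteristic zero. Since edges keep
  their names in cut-subquivers and contractions, one such function serves all quivers at once.
\<close>

section \<open>Quivers\<close>

text \<open>A loop is a cycle in the sense of \<open>pre_digraph.cycle\<close>.\<close>

definition acyclic_quiver :: "('v, 'e) pre_digraph \<Rightarrow> bool" where
  "acyclic_quiver G \<longleftrightarrow> \<not> (\<exists>p. pre_digraph.cycle G p)"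

text \<open>Connected components are the strong components of the symmetrised quiver, in line with the
  library's definition of \<open>connected\<close>.\<close>

definition component_of :: "('v, 'e) pre_digraph \<Rightarrow> 'v \<Rightarrow> 'v set" where
  "component_of H u = pre_digraph.scc_of (mk_symmetric H) u"

definition contraction :: "('v, 'e) pre_digraph \<Rightarrow> ('v, 'e) pre_digraph \<Rightarrow> ('v set, 'e) pre_digraph" where
  "contraction G H =
     \<lparr> verts = component_of H ` verts H,
       arcs = arcs G - arcs H,
       tail = (\<lambda>a. component_of H (tail G a)),
       head = (\<lambda>a. component_of H (head G a)) \<rparr>"

definition tadpoles :: "('v, 'e) pre_digraph \<Rightarrow> 'e set" where
  "tadpoles G = {a \<in> arcs G. tail G a = head G a}"

definition prune :: "('v, 'e) pre_digraph \<Rightarrow> ('v, 'e) pre_digraph" where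
  "prune G = G\<lparr>arcs := arcs G - tadpoles G\<rparr>"

section \<open>The functions \<open>e\<close> and \<open>\<omega>\<close>\<close>

text \<open>Linear extensions, as reflexive total orders on the vertex set that contain the partial order
  induced by an acyclic quiver (an arc \<open>u \<rightarrow> v\<close> gives \<open>u \<le> v\<close>).\<close>

definition linear_extensions :: "('v, 'e) pre_digraph \<Rightarrow> 'v rel set" where
  "linear_extensions G =
     {r. linear_order_on (verts G) r \<and> {(u, v). u \<rightarrow>\<^sup>*\<^bsub>G\<^esub> v} \<subseteq> r}"

definition e0 :: "('v, 'e) pre_digraph \<Rightarrow> 'k::field_char_0" where
  "e0 G = (if acyclic_quiver G
           then of_nat (card (linear_extensions G)) / fact (card (verts G)) else 0)"

definition beta_plus :: "('e \<Rightarrow> 'k::field_char_0) \<Rightarrow> 'e \<Rightarrow> 'k" where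
  "beta_plus \<beta> a = (\<beta> a + 1) / 2"

definition beta_minus :: "('e \<Rightarrow> 'k::field_char_0) \<Rightarrow> 'e \<Rightarrow> 'k" where
  "beta_minus \<beta> a = (\<beta> a - 1) / 2"

definition e_val :: "('e \<Rightarrow> 'k::field_char_0) \<Rightarrow> ('v, 'e) pre_digraph \<Rightarrow> 'k" where
  "e_val \<beta> G = (\<Prod>a\<in>tadpoles G. - beta_minus \<beta> a) * e0 (prune G)"

definition counit :: "('v, 'e) pre_digraph \<Rightarrow> 'k::field_char_0" where
  "counit G = (if arcs G = {} then 1 else 0)"

definition is_omega :: "('e \<Rightarrow> 'k::field_char_0) \<Rightarrow> (('v, 'e) pre_digraph \<Rightarrow> 'k) \<Rightarrow> bool" where
  "is_omega \<beta> w \<longleftrightarrow>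
     (\<forall>G. fin_digraph G \<longrightarrow> (\<Sum>H | spanning H G. w H * e_val \<beta> (contraction G H)) = counit G)"

text \<open>The second condition only fixes the value on records that are not finite quivers. Existence and
  uniqueness are proved in \<open>ex1_omega\<close> below.\<close>

definition omega :: "('e \<Rightarrow> 'k::field_char_0) \<Rightarrow> ('v, 'e) pre_digraph \<Rightarrow> 'k" where
  "omega \<beta> = (THE w. is_omega \<beta> w \<and> (\<forall>G. \<not> fin_digraph G \<longrightarrow> w G = 0))"

definition omega_c :: "('e \<Rightarrow> 'k::field_char_0) \<Rightarrow> ('v, 'e) pre_digraph \<Rightarrow> 'k" where
  "omega_c \<beta> G = (if connected G then omega \<beta> G else 0)"

subsection \<open>Well-definedness of \<open>\<omega>\<close>\<close>

lemma spanning_arcs_cong: "spanning H G \<Longrightarrow> H = G\<lparr>arcs := arcs H\<rparr>"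
  by (auto simp: spanning_def subgraph_def compatible_def)

lemma spanning_self: "fin_digraph G \<Longrightarrow> spanning G G"
  by (simp add: spanning_def subgraph_def compatible_def fin_digraph_def)

lemma spanning_fin_digraph: "spanning H G \<Longrightarrow> fin_digraph G \<Longrightarrow> fin_digraph H"
  unfolding spanning_def subgraph_def fin_digraph_def fin_digraph_axioms_def
  by (metis finite_subset)

lemma spanning_psubset: "spanning H G \<Longrightarrow> H \<noteq> G \<Longrightarrow> arcs H \<subset> arcs G"
  by (auto simp: spanning_def subgraph_def compatible_def)

lemma finite_spanning: "fin_digraph G \<Longrightarrow> finite {H. spanning H G}"
proof -
  assume G: "fin_digraph G"
  have "{H. spanning H G} \<subseteq> (\<lambda>F. G\<lparr>arcs := F\<rparr>) ` Pow (arcs G)"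
  proof
    fix H assume "H \<in> {H. spanning H G}"
    then have H: "spanning H G" by simp
    from spanning_arcs_cong[OF H] show "H \<in> (\<lambda>F. G\<lparr>arcs := F\<rparr>) ` Pow (arcs G)"
    proof (rule image_eqI)
      show "arcs H \<in> Pow (arcs G)"
        using H by (simp add: spanning_def subgraph_def)
    qed
  qed
  moreover have "finite (arcs G)"
    using G by (rule fin_digraph.finite_arcs)
  ultimately show ?thesis
    by (meson finite_Pow_iff finite_imageI finite_subset)
qed

lemma e_val_no_arcs:
  assumes "finite (verts G)" "arcs G = {}"
  shows "e_val \<beta> G \<noteq> (0::'k::field_char_0)"
proof -
  have tad: "tadpoles G = {}" and pr: "prune G = G"
    using assms by (auto simp: tadpoles_def prune_def)
  have ac: "acyclic_quiver G"
    using assms by (auto simp: acyclic_quiver_def pre_digraph.cycle_def pre_digraph.awalk_def)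
  obtain r where r: "well_order_on (verts G) r"
    using well_order_on by blast
  have "{(u, v). u \<rightarrow>\<^sup>*\<^bsub>G\<^esub> v} \<subseteq> Id_on (verts G)"
  proof clarify
    fix u v assume "u \<rightarrow>\<^sup>*\<^bsub>G\<^esub> v"
    then have "(u, v) \<in> rtrancl_on (verts G) {}"
      using assms by (simp add: reachable_def arcs_ends_def)
    then show "(u, v) \<in> Id_on (verts G)"
      by (induction rule: rtrancl_on.induct) auto
  qed
  moreover have "Id_on (verts G) \<subseteq> r"
    using r by (auto simp: order_on_defs refl_on_def)
  ultimately have "r \<in> linear_extensions G"
    using r by (auto simp: linear_extensions_def well_order_on_def)
  moreover have "linear_extensions G \<subseteq> Pow (verts G \<times> verts G)"
    by (auto simp: linear_extensions_def order_on_defs)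
  then have "finite (linear_extensions G)"
    using assms by (meson finite_Pow_iff finite_SigmaI finite_subset)
  ultimately have "card (linear_extensions G) \<noteq> 0"
    by auto
  then show ?thesis
    by (simp add: e_val_def tad pr e0_def ac)
qed

lemma e_val_contraction_self: "fin_digraph G \<Longrightarrow> e_val \<beta> (contraction G G) \<noteq> 0"
  by (rule e_val_no_arcs) (auto simp: contraction_def fin_digraph.finite_verts)

lemma spanning_sum_split:
  assumes "fin_digraph G"
  shows "(\<Sum>H | spanning H G. w H * e_val \<beta> (contraction G H)) =
    w G * e_val \<beta> (contraction G G) +
    (\<Sum>H\<in>{H. spanning H G \<and> H \<noteq> G}. w H * e_val \<beta> (contraction G H))"
proof -
  have "{H. spanning H G} - {G} = {H. spanning H G \<and> H \<noteq> G}"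
    by auto
  then show ?thesis
    using sum.remove[OF finite_spanning[OF assms], of G "\<lambda>H. w H * e_val \<beta> (contraction G H)"]
      spanning_self[OF assms] by simp
qed

function omega_rec :: "('e \<Rightarrow> 'k::field_char_0) \<Rightarrow> ('v, 'e) pre_digraph \<Rightarrow> 'k" where
  "omega_rec \<beta> G =
     (if fin_digraph G
      then (counit G - (\<Sum>H\<in>{H. spanning H G \<and> H \<noteq> G}. omega_rec \<beta> H * e_val \<beta> (contraction G H)))
             / e_val \<beta> (contraction G G)
      else 0)"
  by pat_completeness auto
termination
proof (relation "measure (\<lambda>(\<beta>, G). card (arcs G))")
  fix \<beta> :: "'e \<Rightarrow> 'k" and G H :: "('v, 'e) pre_digraph"
  assume "fin_digraph G" "H \<in> {H. spanning H G \<and> H \<noteq> G}"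
  then show "((\<beta>, H), \<beta>, G) \<in> measure (\<lambda>(\<beta>, G). card (arcs G))"
    by (simp add: psubset_card_mono fin_digraph.finite_arcs spanning_psubset)
qed simp

declare omega_rec.simps [simp del]

lemma is_omega_unique:
  assumes w: "is_omega \<beta> w" and w': "is_omega \<beta> w'" and G: "fin_digraph G"
  shows "w G = w' G"
  using G
proof (induction "card (arcs G)" arbitrary: G rule: less_induct)
  case less
  have "w H = w' H" if "spanning H G" "H \<noteq> G" for H
    using that less
    by (meson fin_digraph.finite_arcs psubset_card_mono spanning_fin_digraph spanning_psubset)
  then have "(\<Sum>H\<in>{H. spanning H G \<and> H \<noteq> G}. w H * e_val \<beta> (contraction G H)) =
      (\<Sum>H\<in>{H. spanning H G \<and> H \<noteq> G}. w' H * e_val \<beta> (contraction G H))"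
    by (intro sum.cong) auto
  moreover have "(\<Sum>H | spanning H G. w H * e_val \<beta> (contraction G H)) =
      (\<Sum>H | spanning H G. w' H * e_val \<beta> (contraction G H))"
    using w w' less.prems by (simp add: is_omega_def)
  ultimately show ?case
    using e_val_contraction_self[OF less.prems, of \<beta>]
    by (simp add: spanning_sum_split[OF less.prems])
qed

lemma is_omega_rec:
  fixes \<beta> :: "'e \<Rightarrow> 'k::field_char_0"
  shows "is_omega \<beta> (omega_rec \<beta> :: ('v, 'e) pre_digraph \<Rightarrow> 'k)"
  unfolding is_omega_def
proof (intro allI impI)
  fix G :: "('v, 'e) pre_digraph"
  assume G: "fin_digraph G"
  show "(\<Sum>H | spanning H G. omega_rec \<beta> H * e_val \<beta> (contraction G H)) = counit G"
    using e_val_contraction_self[OF G, of \<beta>] G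
    unfolding spanning_sum_split[OF G] omega_rec.simps[of \<beta> G] by simp
qed

lemma ex1_omega:
  "\<exists>!w. is_omega \<beta> w \<and> (\<forall>G. \<not> fin_digraph G \<longrightarrow> w G = 0)"
proof (rule ex1I)
  show "is_omega \<beta> (omega_rec \<beta>) \<and> (\<forall>G. \<not> fin_digraph G \<longrightarrow> omega_rec \<beta> G = 0)"
    by (simp add: is_omega_rec omega_rec.simps)
next
  fix w
  assume "is_omega \<beta> w \<and> (\<forall>G. \<not> fin_digraph G \<longrightarrow> w G = 0)"
  then have "w G = omega_rec \<beta> G" for G
    using is_omega_unique[OF _ is_omega_rec, of \<beta> w G]
    by (cases "fin_digraph G") (simp_all add: omega_rec.simps)
  then show "w = omega_rec \<beta>" ..
qed

lemma is_omega_omega: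
  fixes \<beta> :: "'e \<Rightarrow> 'k::field_char_0"
  shows "is_omega \<beta> (omega \<beta> :: ('v, 'e) pre_digraph \<Rightarrow> 'k)"
  unfolding omega_def by (rule theI'[OF ex1_omega, THEN conjunct1])

section \<open>RB graphs\<close>

datatype colour = Red | Blue

type_synonym ('v, 'e) rb_graph = "('v, 'e) pre_digraph \<times> ('e \<Rightarrow> colour)"

definition red_arcs :: "('v, 'e) rb_graph \<Rightarrow> 'e set" where
  "red_arcs R = {a \<in> arcs (fst R). snd R a = Red}"

definition blue_arcs :: "('v, 'e) rb_graph \<Rightarrow> 'e set" where
  "blue_arcs R = {a \<in> arcs (fst R). snd R a = Blue}"

definition omega_RB_c :: "('v, 'e) rb_graph \<Rightarrow> 'k::field_char_0" where
  "omega_RB_c R =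
     (-1) ^ card (blue_arcs R) * omega_c (\<lambda>a. if a \<in> red_arcs R then 1 else -1) (fst R)"

text \<open>Colourings are extensional functions on the arcs, so that each of the \<open>2 ^ card (arcs Q)\<close>
  colourings is counted exactly once.\<close>

definition rb_colourings :: "('v, 'e) pre_digraph \<Rightarrow> ('v, 'e) rb_graph set" where
  "rb_colourings Q = {Q} \<times> (arcs Q \<rightarrow>\<^sub>E UNIV)"

section \<open>Directed-undirected graphs\<close>

text \<open>The set of endpoints of an undirected edge has two elements, or one for an undirected tadpole.\<close>

record ('v, 'e) pre_du_graph =
  du_verts :: "'v set"
  dir_edges :: "'e set"
  undir_edges :: "'e set"
  dir_tail :: "'e \<Rightarrow> 'v"
  dir_head :: "'e \<Rightarrow> 'v"
  undir_ends :: "'e \<Rightarrow> 'v set"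

locale du_graph =
  fixes D :: "('v, 'e) pre_du_graph"
  assumes finite_du_verts: "finite (du_verts D)"
    and finite_dir_edges: "finite (dir_edges D)"
    and finite_undir_edges: "finite (undir_edges D)"
    and edges_disjoint: "dir_edges D \<inter> undir_edges D = {}"
    and dir_tail_in_verts: "a \<in> dir_edges D \<Longrightarrow> dir_tail D a \<in> du_verts D"
    and dir_head_in_verts: "a \<in> dir_edges D \<Longrightarrow> dir_head D a \<in> du_verts D"
    and undir_ends_in_verts: "u \<in> undir_edges D \<Longrightarrow> undir_ends D u \<subseteq> du_verts D"
    and card_undir_ends: "u \<in> undir_edges D \<Longrightarrow> card (undir_ends D u) \<in> {1, 2}"

definition directed_core :: "('v, 'e) pre_du_graph \<Rightarrow> ('v, 'e) pre_digraph" where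
  "directed_core D =
     \<lparr> verts = du_verts D, arcs = dir_edges D, tail = dir_tail D, head = dir_head D \<rparr>"

definition du_tadpoles :: "('v, 'e) pre_du_graph \<Rightarrow> 'e set" where
  "du_tadpoles D = {a \<in> dir_edges D. dir_tail D a = dir_head D a}
                     \<union> {u \<in> undir_edges D. card (undir_ends D u) = 1}"

definition acyclic_du :: "('v, 'e) pre_du_graph \<Rightarrow> bool" where
  "acyclic_du D \<longleftrightarrow> du_tadpoles D = {} \<and> acyclic_quiver (directed_core D)"

definition admissible_completion :: "('v, 'e) pre_du_graph \<Rightarrow> ('v, 'e) pre_digraph \<Rightarrow> bool" where
  "admissible_completion D Q \<longleftrightarrow>
     verts Q = du_verts D \<and> arcs Q = dir_edges D \<union> undir_edges D \<and>
     (\<forall>a\<in>dir_edges D. tail Q a = dir_tail D a \<and> head Q a = dir_head D a) \<and>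
     (\<forall>u\<in>undir_edges D. {tail Q u, head Q u} = undir_ends D u) \<and>
     acyclic_quiver Q"

definition sector_coefficient ::
  "('v, 'e) pre_du_graph \<Rightarrow> ('v, 'e) pre_digraph \<Rightarrow> ('e \<Rightarrow> 'k::field_char_0) \<Rightarrow> ('e \<Rightarrow> 'k) \<Rightarrow> 'k" where
  "sector_coefficient D Q \<beta> \<gamma> =
     (\<Prod>u\<in>undir_edges D. \<gamma> u) *
     (\<Sum>R\<in>rb_colourings Q.
        (\<Prod>a\<in>dir_edges D \<inter> red_arcs R. beta_plus \<beta> a) *
        (\<Prod>a\<in>dir_edges D \<inter> blue_arcs R. beta_minus \<beta> a) * omega_RB_c R)"

end

theory Submission
  imports Defs
begin

text \<open>
  The parameter \<open>\<beta> a\<close> of an arc \<open>a\<close> enters \<open>e(G/H)\<close> only when \<open>a\<close> is a tadpole of \<open>G/H\<close>, that is,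
  when \<open>a \<notin> H\<close> and the endpoints of \<open>a\<close> lie in one component of \<open>H\<close>; it then contributes the affine
  factor \<open>(1 - \<beta> a) / 2\<close>. For \<open>a \<in> H\<close> with endpoints joined in \<open>H - a\<close>, on the other hand,
  \<open>G/H = (G - a)/(H - a)\<close>. Subtracting the recursions for \<open>\<omega>(G)\<close> at \<open>\<beta> a = t\<close> and \<open>\<beta> a = s\<close>,
  and using induction on the number of arcs, the contributions of \<open>H\<close> and \<open>H + a\<close> cancel for every
  \<open>H\<close> without \<open>a\<close> except \<open>H = G - a\<close>, which leaves the deletion formula (lemma \<open>omega_update_diff\<close>):
  the difference of the values of \<open>\<omega>(G)\<close> at \<open>\<beta> a = t\<close> and \<open>\<beta> a = s\<close> is \<open>(t - s) / 2 * \<omega>(G - a)\<close>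
  if the endpoints of \<open>a\<close> are joined in \<open>G - a\<close>, and \<open>0\<close> otherwise. For \<open>\<omega>\<^sub>c\<close> the formula holds
  without a case distinction (lemma \<open>omega_c_update_diff\<close>): when \<open>G\<close> is connected, the endpoints of
  \<open>a\<close> are joined in \<open>G - a\<close> if and only if \<open>G - a\<close> is connected.

  The sector coefficient sums over the two colours of each arc independently. For a directed edge the
  sum over its colour interpolates the affine function \<open>\<omega>\<^sub>c\<close> from its values at \<open>1\<close> and \<open>-1\<close>,
  restoring \<open>\<beta> a\<close>; for an undirected edge it is the difference of these two values, that is,
  \<open>\<omega>\<^sub>c\<close> of the graph with the edge deleted. Induction over the arcs (lemma \<open>sum_colourings_omega_c\<close>)
  leaves \<open>\<omega>\<^sub>c\<close> of the directed core, whatever the orientation chosen for the deleted edges.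
\<close>

section \<open>Connected components and contractions\<close>

text \<open>The equivalence relation on the vertices whose classes are the connected components.\<close>

definition joined :: "('v, 'e) pre_digraph \<Rightarrow> 'v rel" where
  "joined G = rtrancl_on (verts G) (parcs (mk_symmetric G))"

lemma reachable_mk_symmetric_iff_joined: "u \<rightarrow>\<^sup>*\<^bsub>mk_symmetric G\<^esub> v \<longleftrightarrow> (u, v) \<in> joined G"
  by (simp add: joined_def reachable_def)

lemma sym_joined: "sym (joined G)"
  by (rule symI) (metis symmetric_reachable symmetric_mk_symmetric reachable_mk_symmetric_iff_joined)

lemma equiv_joined: "equiv (verts G) (joined G)"
proof (rule equivI)
  show "joined G \<subseteq> verts G \<times> verts G"
    by (auto simp: joined_def dest: in_rtrancl_on_in_F)
  show "refl_on (verts G) (joined G)"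
    by (auto simp: joined_def refl_on_def)
  show "sym (joined G)"
    by (rule sym_joined)
  show "trans (joined G)"
    by (auto simp: joined_def intro!: transI intro: rtrancl_on_trans)
qed

lemma component_of_eq_class: "component_of G u = joined G `` {u}"
  using sym_joined[of G]
  by (auto simp: component_of_def pre_digraph.scc_of_def reachable_mk_symmetric_iff_joined
      dest: symD)

lemma component_of_eq_iff:
  assumes "u \<in> verts G" "v \<in> verts G"
  shows "component_of G u = component_of G v \<longleftrightarrow> (u, v) \<in> joined G"
  unfolding component_of_eq_class by (rule eq_equiv_class_iff[OF equiv_joined assms])

lemma connected_iff_joined: "connected G \<longleftrightarrow> verts G \<noteq> {} \<and> verts G \<times> verts G \<subseteq> joined G"
  by (auto simp: connected_def strongly_connected_def reachable_mk_symmetric_iff_joined)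

lemma joined_cong:
  assumes "verts G = verts G'" "arcs G = arcs G'"
    "\<And>a. a \<in> arcs G \<Longrightarrow> tail G a = tail G' a \<and> head G a = head G' a"
  shows "joined G = joined G'"
proof -
  have "parcs (mk_symmetric G) = parcs (mk_symmetric G')"
    using assms by (auto simp: parcs_mk_symmetric)
  with assms show ?thesis
    by (simp add: joined_def)
qed

lemma joined_mono:
  assumes "A \<subseteq> B"
  shows "joined (G\<lparr>arcs := A\<rparr>) \<subseteq> joined (G\<lparr>arcs := B\<rparr>)"
proof -
  have "parcs (mk_symmetric (G\<lparr>arcs := A\<rparr>)) \<subseteq> parcs (mk_symmetric (G\<lparr>arcs := B\<rparr>))"
    using assms by (auto simp: parcs_mk_symmetric)
  then have "(u, v) \<in> rtrancl_on (verts G) (parcs (mk_symmetric (G\<lparr>arcs := B\<rparr>)))"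
    if "(u, v) \<in> rtrancl_on (verts G) (parcs (mk_symmetric (G\<lparr>arcs := A\<rparr>)))" for u v
    using that by (rule rtrancl_on_mono[OF _ subset_refl])
  then show ?thesis
    by (auto simp: joined_def)
qed

lemma joined_insert_arc:
  assumes "(tail G a, head G a) \<in> joined (G\<lparr>arcs := F\<rparr>)"
  shows "joined (G\<lparr>arcs := insert a F\<rparr>) = joined (G\<lparr>arcs := F\<rparr>)" (is "?L = ?R")
proof
  have ha: "(head G a, tail G a) \<in> ?R"
    using assms sym_joined symD by metis
  have "(u, v) \<in> ?R" if "(u, v) \<in> rtrancl_on (verts G) (parcs (mk_symmetric (G\<lparr>arcs := insert a F\<rparr>)))"
    for u v
    using that
  proof (induction rule: rtrancl_on_induct)
    case base
    then show ?case by (simp add: joined_def)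
  next
    case (step y z)
    have "(y, z) \<in> parcs (mk_symmetric (G\<lparr>arcs := F\<rparr>)) \<or> (y, z) \<in> {(tail G a, head G a), (head G a, tail G a)}"
      using step.hyps by (auto simp: parcs_mk_symmetric)
    then show ?case
    proof
      assume "(y, z) \<in> parcs (mk_symmetric (G\<lparr>arcs := F\<rparr>))"
      with step show ?thesis
        by (auto simp: joined_def intro: rtrancl_on_into_rtrancl_on)
    next
      assume "(y, z) \<in> {(tail G a, head G a), (head G a, tail G a)}"
      then have "(y, z) \<in> ?R" using assms ha by auto
      with step.IH show ?thesis
        unfolding joined_def by (rule rtrancl_on_trans)
    qed
  qed
  then show "?L \<subseteq> ?R"
    by (auto simp: joined_def)
  show "?R \<subseteq> ?L"
    by (rule joined_mono) auto
qed

lemma connected_delete_arc_iff: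
  assumes G: "fin_digraph G" and a: "a \<in> arcs G"
  shows "connected (G\<lparr>arcs := arcs G - {a}\<rparr>) \<longleftrightarrow>
    connected G \<and> (tail G a, head G a) \<in> joined (G\<lparr>arcs := arcs G - {a}\<rparr>)"
    (is "connected ?G' \<longleftrightarrow> _ \<and> ?j")
proof -
  interpret fin_digraph G by (rule G)
  have "joined ?G' \<subseteq> joined G"
    using joined_mono[of "arcs G - {a}" "arcs G" G] by auto
  moreover have "joined ?G' = joined G" if ?j
    using joined_insert_arc[OF that] a by (simp add: insert_absorb)
  moreover have "(tail G a, head G a) \<in> verts G \<times> verts G"
    using a by simp
  ultimately show ?thesis
    by (auto simp: connected_iff_joined)
qed

text \<open>If the endpoints of \<open>a\<close> lie in one component of \<open>F\<close>, then contracting \<open>a\<close> along with \<open>F\<close>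
  amounts to deleting \<open>a\<close> first. The two quivers are equal as records, not just isomorphic.\<close>

lemma contraction_insert_joined:
  assumes "a \<in> arcs G" "(tail G a, head G a) \<in> joined (G\<lparr>arcs := F\<rparr>)"
  shows "contraction G (G\<lparr>arcs := insert a F\<rparr>) =
    contraction (G\<lparr>arcs := arcs G - {a}\<rparr>) (G\<lparr>arcs := F\<rparr>)"
proof -
  have "component_of (G\<lparr>arcs := insert a F\<rparr>) = component_of (G\<lparr>arcs := F\<rparr>)"
    using joined_insert_arc[OF assms(2)] by (simp add: component_of_eq_class fun_eq_iff)
  then show ?thesis
    by (auto simp: contraction_def)
qed

lemma e_val_insert_tadpole:
  assumes "finite (arcs G)" "a \<in> arcs G" "tail G a = head G a"
  shows "e_val \<beta> G = - beta_minus \<beta> a * e_val \<beta> (G\<lparr>arcs := arcs G - {a}\<rparr>)"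
proof -
  let ?G' = "G\<lparr>arcs := arcs G - {a}\<rparr>"
  have t: "tadpoles G = insert a (tadpoles ?G')" "a \<notin> tadpoles ?G'"
    using assms by (auto simp: tadpoles_def)
  have "arcs G - tadpoles G = arcs ?G' - tadpoles ?G'"
    using t by auto
  then have "prune G = prune ?G'"
    by (simp add: prune_def)
  moreover have "finite (tadpoles ?G')"
    using assms by (simp add: tadpoles_def)
  ultimately show ?thesis
    using t by (simp add: e_val_def mult.assoc)
qed

lemma tadpole_contraction_iff:
  assumes "fin_digraph G"
  shows "a \<in> tadpoles (contraction G (G\<lparr>arcs := F\<rparr>)) \<longleftrightarrow>
    a \<in> arcs G - F \<and> (tail G a, head G a) \<in> joined (G\<lparr>arcs := F\<rparr>)"
proof -
  interpret fin_digraph G by (rule assms)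
  show ?thesis
    using component_of_eq_iff[of "tail G a" "G\<lparr>arcs := F\<rparr>" "head G a"]
    by (auto simp: tadpoles_def contraction_def)
qed

section \<open>Locality of \<open>e\<close> and \<open>\<omega>\<close>\<close>

lemma acyclic_quiver_cong:
  assumes "verts G = verts G'" "arcs G = arcs G'"
    "\<And>a. a \<in> arcs G \<Longrightarrow> tail G a = tail G' a \<and> head G a = head G' a"
  shows "acyclic_quiver G \<longleftrightarrow> acyclic_quiver G'"
proof -
  have cas: "pre_digraph.cas G u p v = pre_digraph.cas G' u p v" if "set p \<subseteq> arcs G" for u p v
    using that assms(3) by (induction p arbitrary: u) (auto simp: pre_digraph.cas.simps)
  have vs: "pre_digraph.awalk_verts G u p = pre_digraph.awalk_verts G' u p" if "set p \<subseteq> arcs G" for u p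
    using that assms(3) by (induction p arbitrary: u) (auto simp: pre_digraph.awalk_verts.simps)
  have "pre_digraph.cycle G p = pre_digraph.cycle G' p" for p
    unfolding pre_digraph.cycle_def pre_digraph.awalk_def
    using cas vs assms(1,2) by (metis (no_types, lifting))
  then show ?thesis
    by (simp add: acyclic_quiver_def)
qed

lemma e0_cong:
  assumes "verts G = verts G'" "arcs G = arcs G'"
    "\<And>a. a \<in> arcs G \<Longrightarrow> tail G a = tail G' a \<and> head G a = head G' a"
  shows "e0 G = e0 G'"
proof -
  have "arcs_ends G = arcs_ends G'"
    using assms by (auto simp: arcs_ends_def arc_to_ends_def)
  then have "linear_extensions G = linear_extensions G'"
    by (simp add: linear_extensions_def reachable_def assms(1))
  then show ?thesis
    using acyclic_quiver_cong[OF assms] by (simp add: e0_def assms(1))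
qed

lemma e_val_cong:
  assumes "verts G = verts G'" "arcs G = arcs G'"
    "\<And>a. a \<in> arcs G \<Longrightarrow> tail G a = tail G' a \<and> head G a = head G' a"
    "\<And>a. a \<in> tadpoles G \<Longrightarrow> \<beta> a = \<beta>' a"
  shows "e_val \<beta> G = e_val \<beta>' G'"
proof -
  have t: "tadpoles G = tadpoles G'"
    using assms by (auto simp: tadpoles_def)
  have "e0 (prune G) = (e0 (prune G') :: 'c)"
    by (rule e0_cong) (use assms t in \<open>auto simp: prune_def\<close>)
  moreover have "(\<Prod>a\<in>tadpoles G. - beta_minus \<beta> a) = (\<Prod>a\<in>tadpoles G'. - beta_minus \<beta>' a)"
    using assms(4) by (intro prod.cong) (auto simp: t beta_minus_def)
  ultimately show ?thesis
    by (simp add: e_val_def)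
qed

lemma fin_digraph_restrict_arcs:
  "fin_digraph G \<Longrightarrow> F \<subseteq> arcs G \<Longrightarrow> fin_digraph (G\<lparr>arcs := F\<rparr>)"
  by (auto simp: fin_digraph_def fin_digraph_axioms_def wf_digraph_def intro: finite_subset)

lemma spanning_iff:
  assumes "fin_digraph G"
  shows "spanning H G \<longleftrightarrow> (\<exists>F\<subseteq>arcs G. H = G\<lparr>arcs := F\<rparr>)"
proof
  show "\<exists>F\<subseteq>arcs G. H = G\<lparr>arcs := F\<rparr>" if "spanning H G"
    using spanning_arcs_cong[OF that] that by (auto simp: spanning_def subgraph_def)
  show "spanning H G" if "\<exists>F\<subseteq>arcs G. H = G\<lparr>arcs := F\<rparr>"
    using that assms fin_digraph_restrict_arcs[OF assms]
    by (auto simp: spanning_def subgraph_def compatible_def fin_digraph_def)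
qed

text \<open>The recursion for \<open>\<omega>\<close>, indexed by the arc sets of the cut-subquivers.\<close>

lemma sum_omega_contraction:
  assumes "fin_digraph G"
  shows "(\<Sum>F\<in>Pow (arcs G). omega \<beta> (G\<lparr>arcs := F\<rparr>) * e_val \<beta> (contraction G (G\<lparr>arcs := F\<rparr>)))
    = counit G"
proof -
  have eq: "{H. spanning H G} = (\<lambda>F. G\<lparr>arcs := F\<rparr>) ` Pow (arcs G)"
    by (auto simp: spanning_iff[OF assms])
  have inj: "inj_on (\<lambda>F. G\<lparr>arcs := F\<rparr>) (Pow (arcs G))"
    by (rule inj_onI) (metis pre_digraph.select_convs(2) pre_digraph.surjective pre_digraph.update_convs(2))
  have "(\<Sum>H | spanning H G. omega \<beta> H * e_val \<beta> (contraction G H)) = counit G"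
    using is_omega_omega assms unfolding is_omega_def by blast
  then show ?thesis
    unfolding eq by (simp add: sum.reindex[OF inj])
qed

text \<open>The tail and head functions of a quiver record are also defined off its arcs; these junk values,
  like the parameters of arcs outside the quiver, have no influence on \<open>\<omega>\<close>.\<close>

lemma omega_cong:
  fixes \<beta> \<beta>' :: "'e \<Rightarrow> 'k::field_char_0"
  assumes "fin_digraph G" "verts G = verts G'" "arcs G = arcs G'"
    "\<And>a. a \<in> arcs G \<Longrightarrow> tail G a = tail G' a \<and> head G a = head G' a"
    "\<And>a. a \<in> arcs G \<Longrightarrow> \<beta> a = \<beta>' a"
  shows "omega \<beta> G = omega \<beta>' G'"
  using assms
proof (induction "card (arcs G)" arbitrary: G G' rule: less_induct)
  case less
  have fin: "finite (arcs G)"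
    using less.prems(1) by (rule fin_digraph.finite_arcs)
  have G': "fin_digraph G'"
    using less.prems by (auto simp: fin_digraph_def fin_digraph_axioms_def wf_digraph_def)
  have e: "e_val \<beta> (contraction G (G\<lparr>arcs := F\<rparr>)) = e_val \<beta>' (contraction G' (G'\<lparr>arcs := F\<rparr>))"
    if "F \<subseteq> arcs G" for F
  proof -
    have "joined (G\<lparr>arcs := F\<rparr>) = joined (G'\<lparr>arcs := F\<rparr>)"
      by (rule joined_cong) (use that less.prems in auto)
    then have "component_of (G\<lparr>arcs := F\<rparr>) = component_of (G'\<lparr>arcs := F\<rparr>)"
      by (simp add: component_of_eq_class fun_eq_iff)
    then show ?thesis
      using less.prems by (intro e_val_cong) (auto simp: contraction_def tadpoles_def)
  qed
  have IH: "omega \<beta> (G\<lparr>arcs := F\<rparr>) = omega \<beta>' (G'\<lparr>arcs := F\<rparr>)" if "F \<subset> arcs G" for F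
  proof (rule less.hyps)
    show "card (arcs (G\<lparr>arcs := F\<rparr>)) < card (arcs G)"
      using that fin by (simp add: psubset_card_mono)
    show "fin_digraph (G\<lparr>arcs := F\<rparr>)"
      using that less.prems(1) by (simp add: fin_digraph_restrict_arcs)
  qed (use that less.prems in auto)
  have split: "sum f (Pow (arcs G)) = f (arcs G) + sum f (Pow (arcs G) - {arcs G})" for f :: "_ \<Rightarrow> 'k"
    using fin by (intro sum.remove) auto
  have rest: "(\<Sum>F\<in>Pow (arcs G) - {arcs G}. omega \<beta> (G\<lparr>arcs := F\<rparr>) * e_val \<beta> (contraction G (G\<lparr>arcs := F\<rparr>)))
      = (\<Sum>F\<in>Pow (arcs G) - {arcs G}. omega \<beta>' (G'\<lparr>arcs := F\<rparr>) * e_val \<beta>' (contraction G' (G'\<lparr>arcs := F\<rparr>)))"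
    using e IH by (intro sum.cong) auto
  have G'_eq: "G'\<lparr>arcs := arcs G\<rparr> = G'"
    using less.prems(3) by simp
  let ?r = "\<Sum>F\<in>Pow (arcs G) - {arcs G}.
    omega \<beta>' (G'\<lparr>arcs := F\<rparr>) * e_val \<beta>' (contraction G' (G'\<lparr>arcs := F\<rparr>))"
  have "omega \<beta> G * e_val \<beta> (contraction G G) + ?r = counit G"
    using sum_omega_contraction[OF less.prems(1), of \<beta>] unfolding split rest by simp
  moreover have "omega \<beta>' G' * e_val \<beta>' (contraction G' G') + ?r = counit G'"
    using sum_omega_contraction[OF G', of \<beta>']
    unfolding less.prems(3)[symmetric] split G'_eq .
  moreover have "counit G = (counit G' :: 'k)"
    using less.prems(3) by (simp add: counit_def)
  ultimately have "omega \<beta> G * e_val \<beta> (contraction G G) = omega \<beta>' G' * e_val \<beta>' (contraction G' G')"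
    by (metis (no_types, lifting) add_right_cancel)
  moreover have "e_val \<beta> (contraction G G) = e_val \<beta>' (contraction G' G')"
    using e[of "arcs G"] G'_eq by simp
  ultimately show ?case
    using e_val_contraction_self[OF less.prems(1), of \<beta>] by simp
qed

lemma omega_c_cong:
  assumes "fin_digraph G" "verts G = verts G'" "arcs G = arcs G'"
    "\<And>a. a \<in> arcs G \<Longrightarrow> tail G a = tail G' a \<and> head G a = head G' a"
    "\<And>a. a \<in> arcs G \<Longrightarrow> \<beta> a = \<beta>' a"
  shows "omega_c \<beta> G = omega_c \<beta>' G'"
  using omega_cong[OF assms] joined_cong[OF assms(2-4)] assms(2)
  by (simp add: omega_c_def connected_iff_joined)

section \<open>Changing the parameter of one arc\<close>

lemma e_val_contraction_update_diff:
  fixes \<beta> :: "'e \<Rightarrow> 'k::field_char_0"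
  assumes G: "fin_digraph G" and a: "a \<in> arcs G - F"
  shows "e_val (\<beta>(a := t)) (contraction G (G\<lparr>arcs := F\<rparr>))
      - e_val (\<beta>(a := s)) (contraction G (G\<lparr>arcs := F\<rparr>)) =
    - ((t - s) / 2) * (if (tail G a, head G a) \<in> joined (G\<lparr>arcs := F\<rparr>)
      then e_val \<beta> (contraction (G\<lparr>arcs := arcs G - {a}\<rparr>) (G\<lparr>arcs := F\<rparr>)) else 0)"
proof (cases "(tail G a, head G a) \<in> joined (G\<lparr>arcs := F\<rparr>)")
  case True
  let ?C = "contraction G (G\<lparr>arcs := F\<rparr>)"
  let ?C' = "contraction (G\<lparr>arcs := arcs G - {a}\<rparr>) (G\<lparr>arcs := F\<rparr>)"
  have C': "?C\<lparr>arcs := arcs ?C - {a}\<rparr> = ?C'"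
    by (auto simp: contraction_def)
  have "a \<in> tadpoles ?C"
    using True a by (simp add: tadpole_contraction_iff[OF G])
  then have tad: "a \<in> arcs ?C" "tail ?C a = head ?C a"
    by (auto simp: tadpoles_def)
  have "finite (arcs ?C)"
    using G by (simp add: contraction_def fin_digraph.finite_arcs)
  then have *: "e_val (\<beta>(a := x)) ?C = - beta_minus (\<beta>(a := x)) a * e_val (\<beta>(a := x)) ?C'" for x
    using e_val_insert_tadpole[OF _ tad] C' by simp
  have "e_val (\<beta>(a := x)) ?C' = e_val \<beta> ?C'" for x
    by (rule e_val_cong) (auto simp: tadpoles_def contraction_def)
  with * have "e_val (\<beta>(a := x)) ?C = - ((x - 1) / 2) * e_val \<beta> ?C'" for x
    by (simp add: beta_minus_def)
  with True show ?thesis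
    by (simp add: field_simps)
next
  case False
  have "e_val (\<beta>(a := t)) (contraction G (G\<lparr>arcs := F\<rparr>)) =
      e_val (\<beta>(a := s)) (contraction G (G\<lparr>arcs := F\<rparr>))"
    using False by (intro e_val_cong) (auto simp: tadpole_contraction_iff[OF G])
  with False show ?thesis
    by simp
qed

lemma omega_update_diff:
  fixes \<beta> :: "'e \<Rightarrow> 'k::field_char_0"
  assumes "fin_digraph G" "a \<in> arcs G"
  shows "omega (\<beta>(a := t)) G - omega (\<beta>(a := s)) G =
    (t - s) / 2 * (if (tail G a, head G a) \<in> joined (G\<lparr>arcs := arcs G - {a}\<rparr>)
      then omega \<beta> (G\<lparr>arcs := arcs G - {a}\<rparr>) else 0)"
  using assms
proof (induction "card (arcs G)" arbitrary: G rule: less_induct)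
  case (less G)
  note G = less.prems(1) and a = less.prems(2)
  define A where "A = arcs G - {a}"
  define G' where "G' = G\<lparr>arcs := A\<rparr>"
  define conn where "conn F \<longleftrightarrow> (tail G a, head G a) \<in> joined (G\<lparr>arcs := F\<rparr>)" for F
  define W where "W x F = omega (\<beta>(a := x)) (G\<lparr>arcs := F\<rparr>)" for x F
  define E where "E x F = e_val (\<beta>(a := x)) (contraction G (G\<lparr>arcs := F\<rparr>))" for x F
  have fin: "finite (arcs G)"
    using G by (rule fin_digraph.finite_arcs)
  have A: "arcs G = insert a A" "a \<notin> A" "finite A"
    using a fin by (auto simp: A_def)
  have W_indep: "W x F = omega \<beta> (G\<lparr>arcs := F\<rparr>)" if "F \<subseteq> A" for x F
    unfolding W_def
    by (rule omega_cong) (use that A G in \<open>auto intro!: fin_digraph_restrict_arcs\<close>)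
  have E_indep: "E x (insert a F) = e_val \<beta> (contraction G (G\<lparr>arcs := insert a F\<rparr>))" for x F
    unfolding E_def by (rule e_val_cong) (auto simp: tadpole_contraction_iff[OF G])
  have E_conn: "E x (insert a F) = e_val \<beta> (contraction G' (G\<lparr>arcs := F\<rparr>))" if "conn F" for x F
    using contraction_insert_joined[OF a, of F] that
    by (simp add: E_indep conn_def G'_def A_def)
  have E_diff: "E t F - E s F = - ((t - s) / 2) *
      (if conn F then e_val \<beta> (contraction G' (G\<lparr>arcs := F\<rparr>)) else 0)" if "F \<subseteq> A" for F
  proof -
    have "a \<in> arcs G - F"
      using that A by auto
    then show ?thesis
      unfolding E_def conn_def G'_def A_def by (rule e_val_contraction_update_diff[OF G])
  qed
  have W_diff: "W t (insert a F) - W s (insert a F) =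
      (t - s) / 2 * (if conn F then omega \<beta> (G\<lparr>arcs := F\<rparr>) else 0)" if "F \<subset> A" for F
  proof -
    have sub: "insert a F \<subset> arcs G"
      using that A by auto
    have rm: "insert a F - {a} = F"
      using that A by auto
    show ?thesis
      using less.hyps[of "G\<lparr>arcs := insert a F\<rparr>"] psubset_card_mono[OF fin sub]
        fin_digraph_restrict_arcs[OF G psubset_imp_subset[OF sub]]
      by (simp add: W_def conn_def rm)
  qed
  \<comment> \<open>The recursion, with the cut-subquivers paired as \<open>F\<close> and \<open>F + a\<close>.\<close>
  have rec: "(\<Sum>F\<in>Pow A. W x F * E x F + W x (insert a F) * E x (insert a F)) = counit G" for x
  proof -
    have inj: "inj_on (insert a) (Pow A)"
      using A(2) by (auto simp: inj_on_def)
    have "(\<Sum>F\<in>Pow (arcs G). W x F * E x F) = counit G"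
      unfolding W_def E_def by (rule sum_omega_contraction[OF G])
    moreover have "(\<Sum>F\<in>Pow (arcs G). W x F * E x F) =
        (\<Sum>F\<in>Pow A. W x F * E x F) + (\<Sum>F\<in>insert a ` Pow A. W x F * E x F)"
      unfolding A(1) Pow_insert using A by (intro sum.union_disjoint) auto
    ultimately show ?thesis
      by (simp add: sum.reindex[OF inj] sum.distrib)
  qed
  define T where "T F = W t F * E t F - W s F * E s F +
      (W t (insert a F) * E t (insert a F) - W s (insert a F) * E s (insert a F))" for F
  have T: "T F = omega \<beta> (G\<lparr>arcs := F\<rparr>) * (E t F - E s F) +
      (W t (insert a F) - W s (insert a F)) * e_val \<beta> (contraction G (G\<lparr>arcs := insert a F\<rparr>))"
    if "F \<subseteq> A" for F
    using that by (simp add: T_def W_indep E_indep algebra_simps)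
  have "T F = 0" if "F \<in> Pow A - {A}" for F
  proof -
    have "F \<subset> A" "F \<subseteq> A"
      using that by auto
    then show ?thesis
      using E_conn[of F] by (simp add: T W_diff E_diff E_indep)
  qed
  then have "sum T (Pow A) = T A"
    using A(3) by (subst sum.remove[of _ A]) auto
  moreover have "sum T (Pow A) = 0"
  proof -
    have "sum T (Pow A) = (\<Sum>F\<in>Pow A. W t F * E t F + W t (insert a F) * E t (insert a F))
        - (\<Sum>F\<in>Pow A. W s F * E s F + W s (insert a F) * E s (insert a F))"
      unfolding sum_subtractf[symmetric] by (intro sum.cong) (auto simp: T_def)
    then show ?thesis
      by (simp add: rec)
  qed
  moreover have "e_val \<beta> (contraction G' (G\<lparr>arcs := A\<rparr>)) = e_val \<beta> (contraction G G)" if "conn A"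
    using E_conn[OF that, of t, unfolded E_indep] by (simp add: A(1)[symmetric])
  ultimately have "(W t (insert a A) - W s (insert a A) -
      (t - s) / 2 * (if conn A then omega \<beta> (G\<lparr>arcs := A\<rparr>) else 0)) * e_val \<beta> (contraction G G) = 0"
    using T[of A] E_diff[of A] by (auto simp: A(1)[symmetric] algebra_simps)
  then have "W t (insert a A) - W s (insert a A) =
      (t - s) / 2 * (if conn A then omega \<beta> (G\<lparr>arcs := A\<rparr>) else 0)"
    using e_val_contraction_self[OF G, of \<beta>] by simp
  then show ?case
    using a unfolding W_def conn_def A_def by (simp add: insert_absorb)
qed

lemma omega_c_update_diff:
  fixes \<beta> :: "'e \<Rightarrow> 'k::field_char_0"
  assumes "fin_digraph G" "a \<in> arcs G"
  shows "omega_c (\<beta>(a := t)) G - omega_c (\<beta>(a := s)) G =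
    (t - s) / 2 * omega_c \<beta> (G\<lparr>arcs := arcs G - {a}\<rparr>)"
  using omega_update_diff[OF assms, of \<beta> t s] connected_delete_arc_iff[OF assms]
  by (auto simp: omega_c_def)

section \<open>Summing over colourings\<close>

text \<open>The value that a colour assigns to the parameter of its arc.\<close>

definition colour_value :: "colour \<Rightarrow> 'k::field_char_0" where
  "colour_value c = (case c of Red \<Rightarrow> 1 | Blue \<Rightarrow> -1)"

text \<open>The factor of the arc \<open>a\<close> of colour \<open>c\<close> in the sector coefficient, \<open>U\<close> being the set of
  undirected edges; it includes the share of \<open>a\<close> in the sign \<open>(-1)\<^bsup>b\<^esup>\<close>.\<close>

definition colour_weight :: "'e set \<Rightarrow> ('e \<Rightarrow> 'k::field_char_0) \<Rightarrow> 'e \<Rightarrow> colour \<Rightarrow> 'k" where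
  "colour_weight U \<beta> a c =
     (case c of Red \<Rightarrow> if a \<in> U then 1 else beta_plus \<beta> a
              | Blue \<Rightarrow> if a \<in> U then -1 else - beta_minus \<beta> a)"

lemma UNIV_colour: "(UNIV :: colour set) = {Red, Blue}"
  using colour.exhaust by auto

lemma sum_colour: "sum f (UNIV :: colour set) = f Red + f Blue"
  by (simp add: UNIV_colour)

text \<open>Summing over the colour of one arc deletes an undirected edge and restores the parameter of a
  directed one.\<close>

lemma sum_colour_omega_c:
  fixes \<beta> :: "'e \<Rightarrow> 'k::field_char_0"
  assumes "fin_digraph G" "a \<in> arcs G"
  shows "(\<Sum>c\<in>UNIV. colour_weight U \<beta> a c * omega_c (\<beta>(a := colour_value c)) G) =
    omega_c \<beta> (if a \<in> U then G\<lparr>arcs := arcs G - {a}\<rparr> else G)"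
proof -
  let ?d = "omega_c \<beta> (G\<lparr>arcs := arcs G - {a}\<rparr>)"
  have red: "omega_c (\<beta>(a := 1)) G = omega_c \<beta> G + (1 - \<beta> a) / 2 * ?d"
    using omega_c_update_diff[OF assms, of \<beta> 1 "\<beta> a"]
    by (simp only: fun_upd_triv diff_eq_eq add.commute)
  have blue: "omega_c (\<beta>(a := -1)) G = omega_c \<beta> G + (-1 - \<beta> a) / 2 * ?d"
    using omega_c_update_diff[OF assms, of \<beta> "-1" "\<beta> a"]
    by (simp only: fun_upd_triv diff_eq_eq add.commute)
  show ?thesis
    by (simp add: sum_colour colour_weight_def colour_value_def red blue beta_plus_def
        beta_minus_def field_simps)
qed

text \<open>The colours of the arcs outside \<open>F\<close> are not summed over; these arcs keep the parameters
  \<open>\<beta>\<close>. The case \<open>F = arcs Q\<close> is the sum in the sector coefficient.\<close>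

lemma sum_colourings_omega_c:
  fixes \<beta> :: "'e \<Rightarrow> 'k::field_char_0"
  assumes Q: "fin_digraph Q" and F: "F \<subseteq> arcs Q"
  shows "(\<Sum>c\<in>F \<rightarrow>\<^sub>E UNIV. (\<Prod>a\<in>F. colour_weight U \<beta> a (c a)) *
      omega_c (override_on \<beta> (\<lambda>a. colour_value (c a)) F) Q) =
    omega_c \<beta> (Q\<lparr>arcs := arcs Q - F \<inter> U\<rparr>)"
proof -
  have "finite F"
    using F fin_digraph.finite_arcs[OF Q] by (rule finite_subset)
  then show ?thesis
    using F
  proof (induction F arbitrary: \<beta> rule: finite_induct)
    case empty
    then show ?case by simp
  next
    case (insert a F)
    let ?G = "Q\<lparr>arcs := arcs Q - F \<inter> U\<rparr>"
    have G: "fin_digraph ?G" "a \<in> arcs ?G"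
      using insert by (auto intro: fin_digraph_restrict_arcs[OF Q])
    have "(\<Sum>c\<in>insert a F \<rightarrow>\<^sub>E UNIV. (\<Prod>b\<in>insert a F. colour_weight U \<beta> b (c b)) *
          omega_c (override_on \<beta> (\<lambda>b. colour_value (c b)) (insert a F)) Q) =
        (\<Sum>x\<in>UNIV. \<Sum>c\<in>F \<rightarrow>\<^sub>E UNIV. (\<Prod>b\<in>insert a F. colour_weight U \<beta> b ((c(a := x)) b)) *
          omega_c (override_on \<beta> (\<lambda>b. colour_value ((c(a := x)) b)) (insert a F)) Q)"
      using insert.hyps
      unfolding PiE_insert_eq sum.cartesian_product
      by (subst sum.reindex[OF inj_combinator]) (auto simp: case_prod_beta)
    also have "\<dots> = (\<Sum>x\<in>UNIV. colour_weight U \<beta> a x * (\<Sum>c\<in>F \<rightarrow>\<^sub>E UNIV.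
          (\<Prod>b\<in>F. colour_weight U (\<beta>(a := colour_value x)) b (c b)) *
          omega_c (override_on (\<beta>(a := colour_value x)) (\<lambda>b. colour_value (c b)) F) Q))"
    proof (unfold sum_distrib_left, intro sum.cong refl)
      fix x :: colour and c
      have "(\<Prod>b\<in>F. colour_weight U \<beta> b ((c(a := x)) b)) =
          (\<Prod>b\<in>F. colour_weight U (\<beta>(a := colour_value x)) b (c b))"
        using insert.hyps
        by (intro prod.cong) (auto simp: colour_weight_def beta_plus_def beta_minus_def split: colour.split)
      moreover have "override_on \<beta> (\<lambda>b. colour_value ((c(a := x)) b)) (insert a F) =
          override_on (\<beta>(a := colour_value x)) (\<lambda>b. colour_value (c b)) F"
        using insert.hyps by (auto simp: override_on_def fun_eq_iff)
      ultimately show "(\<Prod>b\<in>insert a F. colour_weight U \<beta> b ((c(a := x)) b)) *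
            omega_c (override_on \<beta> (\<lambda>b. colour_value ((c(a := x)) b)) (insert a F)) Q =
          colour_weight U \<beta> a x * ((\<Prod>b\<in>F. colour_weight U (\<beta>(a := colour_value x)) b (c b)) *
            omega_c (override_on (\<beta>(a := colour_value x)) (\<lambda>b. colour_value (c b)) F) Q)"
        using insert.hyps by (simp add: mult.assoc)
    qed
    also have "\<dots> = (\<Sum>x\<in>UNIV. colour_weight U \<beta> a x * omega_c (\<beta>(a := colour_value x)) ?G)"
      using insert by simp
    also have "\<dots> = omega_c \<beta> (if a \<in> U then ?G\<lparr>arcs := arcs ?G - {a}\<rparr> else ?G)"
      by (rule sum_colour_omega_c[OF G])
    also have "(if a \<in> U then ?G\<lparr>arcs := arcs ?G - {a}\<rparr> else ?G) =
        Q\<lparr>arcs := arcs Q - insert a F \<inter> U\<rparr>"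
      by (auto intro!: arg_cong[of _ _ "\<lambda>X. Q\<lparr>arcs := X\<rparr>"])
    finally show ?case .
  qed
qed

lemma prod_colour_weight:
  fixes \<beta> :: "'e \<Rightarrow> 'k::field_char_0"
  assumes "finite (arcs Q)" "arcs Q = B \<union> U" "B \<inter> U = {}"
  shows "(\<Prod>a\<in>arcs Q. colour_weight U \<beta> a (c a)) =
    (\<Prod>a\<in>B \<inter> red_arcs (Q, c). beta_plus \<beta> a) * (\<Prod>a\<in>B \<inter> blue_arcs (Q, c). beta_minus \<beta> a) *
      (-1) ^ card (blue_arcs (Q, c))"
proof -
  have fin: "finite B" "finite U"
    using assms by (auto intro: finite_subset)
  have "(\<Prod>a\<in>arcs Q. colour_weight U \<beta> a (c a)) =
      (\<Prod>a\<in>arcs Q. (if a \<in> B \<inter> red_arcs (Q, c) then beta_plus \<beta> a else 1) *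
        (if a \<in> B \<inter> blue_arcs (Q, c) then beta_minus \<beta> a else 1) *
        (if a \<in> blue_arcs (Q, c) then -1 else 1))"
  proof (rule prod.cong)
    fix a assume "a \<in> arcs Q"
    then show "colour_weight U \<beta> a (c a) =
        (if a \<in> B \<inter> red_arcs (Q, c) then beta_plus \<beta> a else 1) *
        (if a \<in> B \<inter> blue_arcs (Q, c) then beta_minus \<beta> a else 1) *
        (if a \<in> blue_arcs (Q, c) then -1 else 1)"
      using assms(2,3)
      by (cases "c a") (auto simp: colour_weight_def red_arcs_def blue_arcs_def)
  qed simp
  also have "\<dots> = (\<Prod>a\<in>arcs Q \<inter> (B \<inter> red_arcs (Q, c)). beta_plus \<beta> a) *
      (\<Prod>a\<in>arcs Q \<inter> (B \<inter> blue_arcs (Q, c)). beta_minus \<beta> a) *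
      (\<Prod>a\<in>arcs Q \<inter> blue_arcs (Q, c). -1)"
    using assms(1) by (simp only: prod.distrib prod.inter_restrict)
  also have "arcs Q \<inter> (B \<inter> red_arcs (Q, c)) = B \<inter> red_arcs (Q, c)"
    using assms(2) by auto
  also have "arcs Q \<inter> (B \<inter> blue_arcs (Q, c)) = B \<inter> blue_arcs (Q, c)"
    using assms(2) by auto
  also have "arcs Q \<inter> blue_arcs (Q, c) = blue_arcs (Q, c)"
    by (auto simp: blue_arcs_def)
  finally show ?thesis
    by simp
qed

section \<open>The sector coefficient\<close>

lemma fin_digraph_completion:
  assumes "du_graph D" "admissible_completion D Q"
  shows "fin_digraph Q"
proof -
  interpret du_graph D by (rule assms(1))
  have Q: "verts Q = du_verts D" "arcs Q = dir_edges D \<union> undir_edges D"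
    "\<And>a. a \<in> dir_edges D \<Longrightarrow> tail Q a = dir_tail D a \<and> head Q a = dir_head D a"
    "\<And>u. u \<in> undir_edges D \<Longrightarrow> {tail Q u, head Q u} = undir_ends D u"
    using assms(2) by (auto simp: admissible_completion_def)
  have "tail Q a \<in> verts Q \<and> head Q a \<in> verts Q" if "a \<in> arcs Q" for a
    using that Q undir_ends_in_verts[of a] dir_tail_in_verts[of a] dir_head_in_verts[of a] by force
  then show ?thesis
    using Q(1,2) finite_du_verts finite_dir_edges finite_undir_edges
    by unfold_locales auto
qed

lemma sector_coefficient_eq:
  fixes \<beta> \<gamma> :: "'e \<Rightarrow> 'k::field_char_0"
  assumes D: "du_graph D" and Q: "admissible_completion D Q"
  shows "sector_coefficient D Q \<beta> \<gamma> =
    (\<Prod>u\<in>undir_edges D. \<gamma> u) * omega_c \<beta> (directed_core D)"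
proof -
  interpret du_graph D by (rule D)
  have finQ: "fin_digraph Q"
    by (rule fin_digraph_completion[OF D Q])
  have arcs: "arcs Q = dir_edges D \<union> undir_edges D"
    using Q by (simp add: admissible_completion_def)
  have summand: "(\<Prod>a\<in>dir_edges D \<inter> red_arcs (Q, c). beta_plus \<beta> a) *
        (\<Prod>a\<in>dir_edges D \<inter> blue_arcs (Q, c). beta_minus \<beta> a) * omega_RB_c (Q, c) =
      (\<Prod>a\<in>arcs Q. colour_weight (undir_edges D) \<beta> a (c a)) *
        omega_c (override_on \<beta> (\<lambda>a. colour_value (c a)) (arcs Q)) Q" for c
  proof -
    have "omega_c (\<lambda>a. if a \<in> red_arcs (Q, c) then 1 else -1) Q =
        omega_c (override_on \<beta> (\<lambda>a. colour_value (c a)) (arcs Q)) Q"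
    proof (rule omega_c_cong[OF finQ])
      fix a assume "a \<in> arcs Q"
      then show "(if a \<in> red_arcs (Q, c) then 1 else -1) =
          override_on \<beta> (\<lambda>a. colour_value (c a)) (arcs Q) a"
        by (cases "c a") (auto simp: red_arcs_def colour_value_def)
    qed auto
    then show ?thesis
      by (simp add: omega_RB_c_def mult.assoc
          prod_colour_weight[OF fin_digraph.finite_arcs[OF finQ] arcs edges_disjoint])
  qed
  have "(\<Sum>R\<in>rb_colourings Q. (\<Prod>a\<in>dir_edges D \<inter> red_arcs R. beta_plus \<beta> a) *
        (\<Prod>a\<in>dir_edges D \<inter> blue_arcs R. beta_minus \<beta> a) * omega_RB_c R) =
      (\<Sum>c\<in>arcs Q \<rightarrow>\<^sub>E UNIV. (\<Prod>a\<in>dir_edges D \<inter> red_arcs (Q, c). beta_plus \<beta> a) *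
        (\<Prod>a\<in>dir_edges D \<inter> blue_arcs (Q, c). beta_minus \<beta> a) * omega_RB_c (Q, c))"
    by (rule sum.reindex_bij_witness[of _ "\<lambda>c. (Q, c)" snd]) (auto simp: rb_colourings_def)
  also have "\<dots> = omega_c \<beta> (Q\<lparr>arcs := arcs Q - arcs Q \<inter> undir_edges D\<rparr>)"
    unfolding summand by (rule sum_colourings_omega_c[OF finQ subset_refl])
  also have "\<dots> = omega_c \<beta> (directed_core D)"
  proof (rule omega_c_cong)
    show "fin_digraph (Q\<lparr>arcs := arcs Q - arcs Q \<inter> undir_edges D\<rparr>)"
      by (rule fin_digraph_restrict_arcs[OF finQ]) auto
  qed (use Q edges_disjoint in \<open>auto simp: admissible_completion_def directed_core_def\<close>)
  finally show ?thesis
    by (simp add: sector_coefficient_def)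
qed

theorem theorem9p7:
  fixes D :: "('v, 'e) pre_du_graph" and \<beta> \<gamma> :: "'e \<Rightarrow> 'k::field_char_0"
  assumes "du_graph D" and "acyclic_du D"
  shows "(\<forall>Q. admissible_completion D Q \<longrightarrow>
            sector_coefficient D Q \<beta> \<gamma> =
              (\<Prod>u\<in>undir_edges D. \<gamma> u) * omega_c \<beta> (directed_core D)) \<and>
         (\<forall>Q Q'. admissible_completion D Q \<longrightarrow> admissible_completion D Q' \<longrightarrow>
            sector_coefficient D Q \<beta> \<gamma> = sector_coefficient D Q' \<beta> \<gamma>)"
  using sector_coefficient_eq[OF assms(1)] by (metis (no_types, lifting))

end
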